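(* For every positive integer $n$, \[ \sum_{k=0}^{\lfloor \lg n \rfloor} \sum_{i=0}^{2^k-1} \left\lfloor \frac{n+i}{2^{k+1}} \right\rfloor \;=\; \frac{n}{2}\left(\lfloor \lg n \rfloor + 1\right) - \sum_{k=0}^{\lfloor \lg n \rfloor} 2^k \, \mathrm{Zigzag}\!\left(\frac{n}{2^{k+1}}\right). \]
   Context: $\lg$ denotes the logarithm to base 2. For a real number $x$, $\mathrm{Zigzag}(x) = \min\left(x - \lfloor x \rfloor,\ \lceil x \rceil - x\right)$. *)

theory Defs
  imports Complex_Main
begin

definition Zigzag :: "real \<Rightarrow> real" where
  "Zigzag x = min (x - real_of_int \<lfloor>x\<rfloor>) (real_of_int \<lceil>x\<rceil> - x)"

end

theory Submission
  imports Defs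
begin

text \<open>The identity already holds for each \<open>k\<close> separately. Put M = 2^k and n = 2Mq
  + r with r < 2M. Among the M quotients of n + i by 2M, exactly max(0, r - M) equal q + 1 and the
  others equal q, so the inner sum is Mq + max(0, r - M) (\<open>sum_div_double\<close>). Since M
  Zigzag(n/(2M)) = min(r/2, M - r/2), this is n/2 - M Zigzag(n/(2M))
  (\<open>sum_floor_eq_Zigzag\<close>). Adding up the floor(lg n) + 1 values of \<open>k\<close>
  gives the result.\<close>

lemma Zigzag_eq_min_frac: "Zigzag x = min (frac x) (1 - frac x)"
  \<comment> \<open>At an integer the ceiling term is 0 while \<open>1 - frac x\<close> is 1, but
    both minima are 0.\<close>
  by (cases "x \<in> \<int>") (auto simp: Zigzag_def frac_def ceiling_altdef algebra_simps elim!: Ints_cases)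

lemma card_atLeastLessThan_shift:
  fixes r M :: nat
  assumes "r < 2 * M"
  shows "card {i. i < M \<and> 2 * M \<le> r + i} = r - M"
proof -
  have "{i. i < M \<and> 2 * M \<le> r + i} = {2 * M - r..<M}"
    by auto
  then show ?thesis
    using assms by simp
qed

text \<open>The last summand counts the indices where adding \<open>i\<close> to the remainder
  carries past \<open>2 * M\<close>; truncated subtraction makes it 0 when the remainder is at most
  \<open>M\<close>.\<close>

lemma sum_div_double:
  fixes n M :: nat
  assumes "M > 0"
  shows "(\<Sum>i<M. (n + i) div (2 * M)) = M * (n div (2 * M)) + (n mod (2 * M) - M)"
proof -
  define q r where "q = n div (2 * M)" and "r = n mod (2 * M)"
  have n: "n = r + 2 * M * q" and r: "r < 2 * M"
    using assms by (simp_all add: q_def r_def)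
  have "(n + i) div (2 * M) = q + (if 2 * M \<le> r + i then 1 else 0)" if "i < M" for i
  proof -
    have "(n + i) div (2 * M) = q + (r + i) div (2 * M)"
      using div_mult_self2[of "2 * M" "r + i" q] assms by (simp add: n add_ac)
    \<comment> \<open>At most one carry occurs, because \<open>r + i\<close> stays below
      \<open>4 * M\<close>.\<close>
    moreover have "(r + i) div (2 * M) = (if 2 * M \<le> r + i then 1 else 0)"
      using r that by (auto simp: div_nat_eqI)
    ultimately show ?thesis by simp
  qed
  then have "(\<Sum>i<M. (n + i) div (2 * M)) = (\<Sum>i<M. q + (if 2 * M \<le> r + i then 1 else 0))"
    by simp
  also have "\<dots> = M * q + card {i. i < M \<and> 2 * M \<le> r + i}"
    by (simp add: sum.distrib sum.If_cases Int_def)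
  finally show ?thesis
    using card_atLeastLessThan_shift[OF r] by (simp add: q_def r_def)
qed

text \<open>With \<open>r\<close> the remainder, both sides agree because r/2 - min(r/2, M - r/2) =
  max(0, r - M).\<close>

lemma sum_floor_eq_Zigzag:
  fixes n M :: nat
  assumes "M > 0"
  shows "(\<Sum>i<M. real_of_int \<lfloor>(real n + real i) / (2 * real M)\<rfloor>)
       = real n / 2 - real M * Zigzag (real n / (2 * real M))"
proof -
  define q r where "q = n div (2 * M)" and "r = n mod (2 * M)"
  have n: "n = 2 * M * q + r" and r: "r < 2 * M"
    using assms by (simp_all add: q_def r_def)
  have floor: "\<lfloor>real a / (2 * real M)\<rfloor> = int (a div (2 * M))" for a
    using floor_divide_of_nat_eq[of a "2 * M", where 'a = real] by simp
  have "frac (real n / (2 * real M)) = real r / (2 * real M)"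
    using assms by (simp add: frac_def floor flip: q_def) (simp add: n field_simps)
  then have "real M * Zigzag (real n / (2 * real M)) = min (real r / 2) (real M - real r / 2)"
    using assms by (simp add: Zigzag_eq_min_frac min_mult_distrib_left right_diff_distrib)
  moreover have "(\<Sum>i<M. real_of_int \<lfloor>(real n + real i) / (2 * real M)\<rfloor>)
      = real (\<Sum>i<M. (n + i) div (2 * M))"
    by (simp add: floor flip: of_nat_add)
  \<comment> \<open>Over the reals the truncated difference \<open>r - M\<close> has to become a
    maximum with 0.\<close>
  moreover have "\<dots> = real M * real q + max 0 (real r - real M)"
    unfolding sum_div_double[OF assms] by (auto simp: max_def simp flip: q_def r_def)
  moreover have "real n = 2 * (real M * real q) + real r"
    by (simp add: n)
  ultimately show ?thesis
    by linarith
qed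

theorem theorem2p5:
  fixes n :: nat
  assumes "n > 0"
  shows "(\<Sum>k = 0..nat \<lfloor>log 2 (real n)\<rfloor>. \<Sum>i = 0..(2::nat) ^ k - 1.
            real_of_int \<lfloor>(real n + real i) / 2 ^ (k + 1)\<rfloor>)
       = real n / 2 * (real_of_int \<lfloor>log 2 (real n)\<rfloor> + 1)
         - (\<Sum>k = 0..nat \<lfloor>log 2 (real n)\<rfloor>. 2 ^ k * Zigzag (real n / 2 ^ (k + 1)))"
proof -
  have inner: "(\<Sum>i = 0..(2::nat) ^ k - 1. real_of_int \<lfloor>(real n + real i) / 2 ^ (k + 1)\<rfloor>)
      = real n / 2 - 2 ^ k * Zigzag (real n / 2 ^ (k + 1))" for k
  proof -
    have "{0..(2::nat) ^ k - 1} = {..<2 ^ k}"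
      by (simp add: atLeast0AtMost flip: lessThan_Suc_atMost)
    then show ?thesis
      using sum_floor_eq_Zigzag[of "2 ^ k" n] by simp
  qed
  \<comment> \<open>From n \<ge> 1 the logarithm is nonnegative, so \<open>nat\<close> does not
    truncate and the number of summands is the expected one.\<close>
  have "real (nat \<lfloor>log 2 (real n)\<rfloor>) = real_of_int \<lfloor>log 2 (real n)\<rfloor>"
    using assms by simp
  then show ?thesis
    by (simp only: inner sum_subtractf) (simp add: algebra_simps)
qed

end
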